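(* Let $G$ be a finite simple graph with vertex set $V(G)=\{v_1,\dots,v_k,\dots,v_n\}$, where $1<k<n$. Suppose that (1) $\bigcup_{i=1}^{k}N[v_i]=V(G)$; (2) $N[v_1]\cap \bigcup_{i=2}^{k}N[v_i]=\emptyset$; (3) $|d(v_i)-d(v_j)|\neq 1$ for every $i\in\{1,\dots,k\}$ and every $j\in\{1,\dots,n\}\setminus\{i\}$; (4) $\{v\in V(G)\mid d(v)=d(v_1)\}=\{v_1\}$; and (5) $\{v\in V(G)\mid d(v)=d(v_i)\}\subseteq\{v_2,\dots,v_k\}$ for every $i\in\{2,\dots,k\}$. Then $G$ is reconstructible.
   Context: All graphs are finite and simple. For a graph $G$ and $v\in V(G)$, $N(v)=\{u\in V(G)\mid uv\in E(G)\}$ is the open neighbourhood, $N[v]=N(v)\cup\{v\}$ the closed neighbourhood, and $d(v)=|N(v)|$ the degree of $v$ in $G$. $G-v$ denotes the graph obtained from $G$ by deleting $v$ and all edges incident to it. A graph $G$ with $V(G)=\{v_1,\dots,v_n\}$ is reconstructible if every graph $G'$ with $V(G')=\{v'_1,\dots,v'_n\}$ such that $G-v_j\cong G'-v'_j$ for every $j\in\{1,\dots,n\}$ is isomorphic to $G$. *)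

theory Defs
  imports "Graph_Theory.Pair_Digraph" "Graph_Theory.Digraph_Isomorphism"
begin

text \<open>
  A finite simple graph is a \<^locale>\<open>pair_graph\<close>: a finite, symmetric, loop-free set of
  pairs of vertices, where an edge $uv$ is represented by the two arcs $(u,v)$ and $(v,u)$.
\<close>

definition nbhd :: "'a pair_pre_digraph \<Rightarrow> 'a \<Rightarrow> 'a set" where
  "nbhd G v = {u \<in> pverts G. (u, v) \<in> parcs G}"

definition closed_nbhd :: "'a pair_pre_digraph \<Rightarrow> 'a \<Rightarrow> 'a set" where
  "closed_nbhd G v = nbhd G v \<union> {v}"

definition degree :: "'a pair_pre_digraph \<Rightarrow> 'a \<Rightarrow> nat" where
  "degree G v = card (nbhd G v)"

text \<open>
  On graphs of the form \<^term>\<open>with_proj G\<close> the tail and head maps are the two projections,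
  so \<^const>\<open>digraph_iso\<close> between them is the existence of a bijection of the
  vertex sets that preserves and reflects adjacency.

  A definition cannot quantify over the type of vertices of $G'$, hence the type argument; a
  theorem concluding \<open>reconstructible TYPE('b) G\<close> with free \<open>'b\<close> covers graphs $G'$ over
  every vertex type.
\<close>

definition reconstructible :: "'b itself \<Rightarrow> 'a pair_pre_digraph \<Rightarrow> bool" where
  "reconstructible T G \<longleftrightarrow>
    (\<forall>(G' :: 'b pair_pre_digraph) (n :: nat) v v'.
      pair_graph G' \<longrightarrow>
      bij_betw v {1..n} (pverts G) \<longrightarrow>
      bij_betw v' {1..n} (pverts G') \<longrightarrow>
      (\<forall>j\<in>{1..n}. digraph_iso (pre_digraph.del_vert (with_proj G) (v j))
                                 (pre_digraph.del_vert (with_proj G') (v' j))) \<longrightarrow>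
      digraph_iso (with_proj G) (with_proj G'))"

end

theory Submission
  imports Defs
begin

text \<open>
  Write $S = \{v_2, \dots, v_k\}$ and let primes denote corresponding vertices of a graph $G'$ with
  the same cards. Kelly's counting arguments show that corresponding vertices have equal degrees
  and equal sums of the degrees of their neighbours. In a card $G - s$ with $s \in S$ the vertex
  $v_1$ is recognised by its degree, and the degrees of its neighbours are those in $G$, because
  $s$ and $v_1$ have no common neighbour. In $G' - s'$ the sum of these degrees falls short of
  the sum in $G'$ by the number of common neighbours of $s'$ and $v_1'$, so there are none.
  In the card at $v_1$ the set $S$ is recognised by its degrees, and in both graphs the
  neighbours of the deleted vertex are exactly the vertices outside the closed neighbourhood of
  $S$. Hence an isomorphism between the two cards extends to $G$ and $G'$.
\<close>

section \<open>Cards of a graph and isomorphisms between them\<close>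

text \<open>The degree of \<open>u\<close> in the card \<open>G - x\<close>, expressed inside
  \<open>G\<close> so that degrees in a card and in the whole graph can be compared
  directly.\<close>

definition card_degree :: "'a pair_pre_digraph \<Rightarrow> 'a \<Rightarrow> 'a \<Rightarrow> nat" where
  "card_degree G x u = card (nbhd G u - {x})"

text \<open>An isomorphism from \<open>G - x\<close> to \<open>H - y\<close> as a bare vertex map:
  arcs are pairs of vertices, so the arc map of \<open>digraph_iso\<close> carries no further
  information.\<close>

definition card_iso ::
    "'a pair_pre_digraph \<Rightarrow> 'a \<Rightarrow> 'b pair_pre_digraph \<Rightarrow> 'b \<Rightarrow> ('a \<Rightarrow> 'b) \<Rightarrow> bool" where
  "card_iso G x H y f \<longleftrightarrow> bij_betw f (pverts G - {x}) (pverts H - {y}) \<and>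
    (\<forall>u\<in>pverts G - {x}. \<forall>w\<in>pverts G - {x}. (u, w) \<in> parcs G \<longleftrightarrow> (f u, f w) \<in> parcs H)"

lemma digraph_iso_del_vert_imp_card_iso:
  assumes "digraph_iso (pre_digraph.del_vert (with_proj G) x)
                       (pre_digraph.del_vert (with_proj H) y)"
  shows "\<exists>f. card_iso G x H y f"
proof -
  let ?G = "pre_digraph.del_vert (with_proj G) x"
  let ?H = "pre_digraph.del_vert (with_proj H) y"
  obtain h where h: "pre_digraph.digraph_isomorphism ?G h" and H: "?H = app_iso h ?G"
    using assms unfolding digraph_iso_def by blast
  have wf: "wf_digraph ?G" and inj: "inj_on (iso_verts h) (pverts G - {x})"
    and tl: "\<And>a. a \<in> arcs ?G \<Longrightarrow> iso_verts h (fst a) = iso_tail h (iso_arcs h a)"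
    and hd: "\<And>a. a \<in> arcs ?G \<Longrightarrow> iso_verts h (snd a) = iso_head h (iso_arcs h a)"
    using h unfolding pre_digraph.digraph_isomorphism_def by (auto simp: pre_digraph.del_vert_simps)
  have "tail ?H = iso_tail h" "head ?H = iso_head h" by (simp_all add: H)
  \<comment> \<open>The tail and head maps of \<open>?H\<close> are the projections, hence so are
    those stored in \<open>h\<close>. This forces \<open>iso_arcs h\<close> to act on an arc by
    applying \<open>iso_verts h\<close> to both ends.\<close>
  then have [simp]: "iso_tail h = fst" "iso_head h = snd" by (simp_all add: pre_digraph.del_vert_simps)
  have arc: "iso_arcs h (u, w) = (iso_verts h u, iso_verts h w)" if "(u, w) \<in> arcs ?G" for u w
    using tl[OF that] hd[OF that] by (simp add: prod_eq_iff)
  have verts_H: "iso_verts h ` (pverts G - {x}) = pverts H - {y}"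
    using arg_cong[OF H, of verts] by (simp add: pre_digraph.del_vert_simps)
  have arcs_H: "arcs ?H = iso_arcs h ` arcs ?G" by (simp add: H)
  have "(u, w) \<in> parcs G \<longleftrightarrow> (iso_verts h u, iso_verts h w) \<in> parcs H"
    if u: "u \<in> pverts G - {x}" and w: "w \<in> pverts G - {x}" for u w
  proof
    assume "(u, w) \<in> parcs G"
    then have a: "(u, w) \<in> arcs ?G" using u w by (auto simp: pre_digraph.del_vert_simps)
    then have "(iso_verts h u, iso_verts h w) \<in> arcs ?H"
      unfolding arcs_H using arc[OF a] by force
    then show "(iso_verts h u, iso_verts h w) \<in> parcs H" by (simp add: pre_digraph.del_vert_simps)
  next
    assume "(iso_verts h u, iso_verts h w) \<in> parcs H"
    moreover have "iso_verts h u \<noteq> y" "iso_verts h w \<noteq> y" using u w verts_H by blast+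
    ultimately have "(iso_verts h u, iso_verts h w) \<in> arcs ?H" by (simp add: pre_digraph.del_vert_simps)
    then obtain p q where a: "(p, q) \<in> arcs ?G"
      and eq: "iso_arcs h (p, q) = (iso_verts h u, iso_verts h w)"
      unfolding arcs_H by force
    \<comment> \<open>Injectivity of \<open>iso_verts h\<close> is known only on the vertices of the
      card, so the ends of the arc found must first be placed there.\<close>
    have "p \<in> pverts G - {x}" "q \<in> pverts G - {x}"
      using wf_digraph.wellformed[OF wf a] by (simp_all add: pre_digraph.del_vert_simps)
    then have "p = u" "q = w" using eq arc[OF a] u w inj by (auto dest: inj_onD)
    then show "(u, w) \<in> parcs G" using a by (simp add: pre_digraph.del_vert_simps)
  qed
  then have "card_iso G x H y (iso_verts h)"
    unfolding card_iso_def using inj verts_H by (simp add: bij_betw_def)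
  then show ?thesis by blast
qed

context pair_graph
begin

text \<open>The way back from vertex maps: the arc map has to be \<open>map_prod f f\<close>. It is
  injective because arcs of \<open>G\<close> end in vertices of \<open>G\<close>, and it reaches
  every arc of \<open>H\<close> because these end in vertices of \<open>H\<close>, all of which are
  values of \<open>f\<close>.\<close>

lemma digraph_isoI_with_proj:
  assumes "pair_graph H" and bij: "bij_betw f (pverts G) (pverts H)"
    and adj: "\<And>u w. u \<in> pverts G \<Longrightarrow> w \<in> pverts G \<Longrightarrow>
      (u, w) \<in> parcs G \<longleftrightarrow> (f u, f w) \<in> parcs H"
  shows "digraph_iso (with_proj G) (with_proj H)"
proof -
  interpret H: pair_graph H by fact
  let ?h = "\<lparr>iso_verts = f, iso_arcs = map_prod f f, iso_head = snd, iso_tail = fst\<rparr>"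
  have inj: "inj_on f (pverts G)" and im: "f ` pverts G = pverts H"
    using bij by (auto simp: bij_betw_def)
  have sub: "parcs G \<subseteq> pverts G \<times> pverts G" using in_arcsD1 in_arcsD2 by auto
  have "inj_on (map_prod f f) (parcs G)"
    by (rule inj_on_subset[OF map_prod_inj_on[OF inj inj] sub])
  then have "pre_digraph.digraph_isomorphism (with_proj G) ?h"
    unfolding pre_digraph.digraph_isomorphism_def using inj wf_digraph_axioms by simp
  moreover have "map_prod f f ` parcs G = parcs H"
  proof
    show "map_prod f f ` parcs G \<subseteq> parcs H"
    proof clarsimp
      fix u w assume "(u, w) \<in> parcs G"
      then show "(f u, f w) \<in> parcs H" using adj[OF in_arcsD1 in_arcsD2] by blast
    qed
    show "parcs H \<subseteq> map_prod f f ` parcs G"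
    proof
      fix e assume "e \<in> parcs H"
      moreover obtain p q where e: "e = (p, q)" by (cases e)
      ultimately have pq: "(p, q) \<in> parcs H" by simp
      then have "p \<in> f ` pverts G" "q \<in> f ` pverts G"
        unfolding im by (rule H.in_arcsD1 H.in_arcsD2)+
      then obtain u w where uw: "p = f u" "q = f w" "u \<in> pverts G" "w \<in> pverts G" by blast
      then have "(u, w) \<in> parcs G" using adj pq by blast
      then show "e \<in> map_prod f f ` parcs G" by (rule rev_image_eqI) (simp add: e uw)
    qed
  qed
  then have "with_proj H = app_iso ?h (with_proj G)"
    unfolding app_iso_def using im by (simp add: with_proj_def)
  ultimately show ?thesis unfolding digraph_iso_def by blast
qed

section \<open>Neighbourhoods and degrees in a single card\<close>

lemma nbhd_sym: "u \<in> nbhd G w \<longleftrightarrow> w \<in> nbhd G u"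
  unfolding nbhd_def using arcs_symmetric in_arcsD1 by blast

lemma nbhd_irrefl: "u \<notin> nbhd G u"
  unfolding nbhd_def using no_loops' by blast

lemma nbhd_subset: "nbhd G u \<subseteq> pverts G"
  by (auto simp: nbhd_def)

lemma finite_nbhd: "finite (nbhd G u)"
  using nbhd_subset pair_finite_verts finite_subset by blast

lemma degree_eq_card_degree: "degree G u = card_degree G x u + of_bool (u \<in> nbhd G x)"
  using card_Suc_Diff1[OF finite_nbhd, of x u] nbhd_sym[of u x]
  by (auto simp: degree_def card_degree_def)

lemma degree_pos: "u \<in> nbhd G w \<Longrightarrow> 0 < degree G u"
  using degree_eq_card_degree[of u w] by simp

text \<open>Passing to the card drops the term of \<open>x\<close> and lowers the degree of each
  neighbour of \<open>x\<close> by one. With \<open>f\<close> arbitrary, the sum of degrees and the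
  sum of their squares are both instances. The natural subtraction is exact, since a neighbour of
  \<open>x\<close> has positive degree.\<close>

lemma sum_card_degree:
  fixes f :: "nat \<Rightarrow> int"
  assumes "x \<in> pverts G"
  shows "(\<Sum>u\<in>pverts G - {x}. f (card_degree G x u)) =
    (\<Sum>u\<in>pverts G. f (degree G u)) - f (degree G x)
      - (\<Sum>u\<in>nbhd G x. f (degree G u) - f (degree G u - 1))"
proof -
  have "(\<Sum>u\<in>pverts G - {x}. f (card_degree G x u)) =
    (\<Sum>u\<in>pverts G - {x}. f (degree G u) -
      (if u \<in> nbhd G x then f (degree G u) - f (degree G u - 1) else 0))"
    by (rule sum.cong) (simp_all add: degree_eq_card_degree[of _ x])
  also have "\<dots> = (\<Sum>u\<in>pverts G - {x}. f (degree G u)) -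
      (\<Sum>u\<in>(pverts G - {x}) \<inter> nbhd G x. f (degree G u) - f (degree G u - 1))"
    by (subst sum_subtractf, subst sum.inter_restrict) (simp_all only: pair_finite_verts finite_Diff)
  also have "(pverts G - {x}) \<inter> nbhd G x = nbhd G x"
    using nbhd_subset nbhd_irrefl by blast
  finally show ?thesis
    using assms pair_finite_verts by (simp add: sum_diff1)
qed

end

lemma card_iso_nbhd:
  assumes "card_iso G x H y f" and "u \<in> pverts G - {x}"
  shows "f ` (nbhd G u - {x}) = nbhd H (f u) - {y}"
proof
  have im: "f ` (pverts G - {x}) = pverts H - {y}"
    and adj: "\<And>u w. u \<in> pverts G - {x} \<Longrightarrow> w \<in> pverts G - {x} \<Longrightarrow>
      (u, w) \<in> parcs G \<longleftrightarrow> (f u, f w) \<in> parcs H"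
    using assms(1) unfolding card_iso_def bij_betw_def by blast+
  show "f ` (nbhd G u - {x}) \<subseteq> nbhd H (f u) - {y}"
    using im adj assms(2) unfolding nbhd_def by blast
  show "nbhd H (f u) - {y} \<subseteq> f ` (nbhd G u - {x})"
  proof
    fix z assume z: "z \<in> nbhd H (f u) - {y}"
    then have "z \<in> pverts H - {y}" by (simp add: nbhd_def)
    then obtain w where w: "w \<in> pverts G - {x}" "z = f w" using im by blast
    then show "z \<in> f ` (nbhd G u - {x})" using z adj[OF w(1) assms(2)] by (simp add: nbhd_def)
  qed
qed

lemma card_iso_inj_on_nbhd:
  assumes "card_iso G x H y f"
  shows "inj_on f (nbhd G u - {x})"
proof (rule inj_on_subset)
  show "inj_on f (pverts G - {x})" using assms by (simp add: card_iso_def bij_betw_def)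
qed (auto simp: nbhd_def)

lemma card_iso_card_degree:
  assumes "card_iso G x H y f" and "u \<in> pverts G - {x}"
  shows "card_degree H y (f u) = card_degree G x u"
  unfolding card_degree_def card_iso_nbhd[OF assms, symmetric]
  by (intro card_image card_iso_inj_on_nbhd) fact

section \<open>Kelly's counting arguments for graphs with the same cards\<close>

text \<open>\<open>\<tau>\<close> only pairs up the deleted vertices; the isomorphism of two cards
  may vary with \<open>x\<close> and need not agree with \<open>\<tau>\<close>. The bound
  \<open>card_ge\<close> makes the factor \<open>card (pverts G) - 2\<close> in
  \<open>degree_\<tau>\<close> cancellable.\<close>

locale hypomorphism = G: pair_graph G + H: pair_graph H
  for G :: "'a pair_pre_digraph" and H :: "'b pair_pre_digraph" +
  fixes \<tau> :: "'a \<Rightarrow> 'b"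
  assumes bij: "bij_betw \<tau> (pverts G) (pverts H)"
    and cards: "\<And>x. x \<in> pverts G \<Longrightarrow> \<exists>f. card_iso G x H (\<tau> x) f"
    and card_ge: "3 \<le> card (pverts G)"
begin

lemma \<tau>_in_verts: "x \<in> pverts G \<Longrightarrow> \<tau> x \<in> pverts H"
  using bij bij_betwE by blast

lemma sum_card_degree_eq:
  fixes f :: "nat \<Rightarrow> int"
  assumes "x \<in> pverts G"
  shows "(\<Sum>u\<in>pverts G - {x}. f (card_degree G x u)) =
    (\<Sum>u\<in>pverts H - {\<tau> x}. f (card_degree H (\<tau> x) u))"
proof -
  obtain \<phi> where \<phi>: "card_iso G x H (\<tau> x) \<phi>" using cards assms by blast
  then have "bij_betw \<phi> (pverts G - {x}) (pverts H - {\<tau> x})" by (simp add: card_iso_def)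
  then have "(\<Sum>u\<in>pverts H - {\<tau> x}. f (card_degree H (\<tau> x) u)) =
      (\<Sum>u\<in>pverts G - {x}. f (card_degree H (\<tau> x) (\<phi> u)))"
    by (rule sum.reindex_bij_betw[symmetric])
  also have "\<dots> = (\<Sum>u\<in>pverts G - {x}. f (card_degree G x u))"
    by (rule sum.cong) (simp_all add: card_iso_card_degree[OF \<phi>])
  finally show ?thesis by simp
qed

text \<open>The degree sum of the card at \<open>x\<close> is the total \<open>E\<close> minus twice
  the degree of \<open>x\<close>. Adding this over all \<open>x\<close> gives
  \<open>(n - 2) * E\<close> for \<open>n\<close> vertices, so both graphs have the same total, and
  the degree can be read off from a single card.\<close>

lemma degree_\<tau>:
  assumes "x \<in> pverts G"
  shows "degree H (\<tau> x) = degree G x"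
proof -
  define E where "E = (\<Sum>u\<in>pverts G. int (degree G u))"
  define E' where "E' = (\<Sum>u\<in>pverts H. int (degree H u))"
  have "(\<Sum>u\<in>nbhd G x. int (degree G u) - int (degree G u - 1)) = (\<Sum>u\<in>nbhd G x. 1)" for x
    by (rule sum.cong) (auto dest: G.degree_pos)
  then have G: "(\<Sum>u\<in>pverts G - {x}. int (card_degree G x u)) = E - 2 * int (degree G x)"
    if "x \<in> pverts G" for x
    using G.sum_card_degree[OF that, of int] by (simp add: E_def degree_def)
  have "(\<Sum>u\<in>nbhd H x. int (degree H u) - int (degree H u - 1)) = (\<Sum>u\<in>nbhd H x. 1)" for x
    by (rule sum.cong) (auto dest: H.degree_pos)
  then have H: "(\<Sum>u\<in>pverts H - {x}. int (card_degree H x u)) = E' - 2 * int (degree H x)"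
    if "x \<in> pverts H" for x
    using H.sum_card_degree[OF that, of int] by (simp add: E'_def degree_def)
  have eq: "E - 2 * int (degree G x) = E' - 2 * int (degree H (\<tau> x))" if "x \<in> pverts G" for x
    using G[OF that] H[OF \<tau>_in_verts[OF that]] sum_card_degree_eq[OF that, of int] by simp
  have "(\<Sum>x\<in>pverts G. E - 2 * int (degree G x)) =
      (\<Sum>x\<in>pverts G. E' - 2 * int (degree H (\<tau> x)))"
    by (rule sum.cong) (simp_all add: eq)
  moreover have "(\<Sum>x\<in>pverts G. int (degree H (\<tau> x))) = E'"
    unfolding E'_def by (rule sum.reindex_bij_betw[OF bij])
  ultimately have "(int (card (pverts G)) - 2) * E = (int (card (pverts G)) - 2) * E'"
    by (simp add: sum_subtractf sum_distrib_left[symmetric] E_def[symmetric] algebra_simps)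
  then have "E = E'" using card_ge by simp
  then show ?thesis using eq[OF assms] by simp
qed

lemma card_nbhd_\<tau>: "x \<in> pverts G \<Longrightarrow> card (nbhd H (\<tau> x)) = card (nbhd G x)"
  using degree_\<tau> by (simp add: degree_def)

text \<open>Comparing the sums of the squares of the degrees determines $\sum_{u \in N(x)} (2 d(u) - 1)$.\<close>

lemma sum_nbhd_degree_\<tau>:
  assumes x: "x \<in> pverts G"
  shows "(\<Sum>u\<in>nbhd H (\<tau> x). int (degree H u)) = (\<Sum>u\<in>nbhd G x. int (degree G u))"
proof -
  let ?f = "\<lambda>m. (int m)\<^sup>2"
  \<comment> \<open>The guard matters: at \<open>m = 0\<close> natural subtraction makes the left
    side 0, whereas the right side is -1.\<close>
  have sq: "?f m - ?f (m - 1) = 2 * int m - 1" if "0 < m" for m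
    using that by (simp add: of_nat_diff power2_eq_square algebra_simps)
  have "(\<Sum>u\<in>pverts H. ?f (degree H u)) = (\<Sum>u\<in>pverts G. ?f (degree H (\<tau> u)))"
    by (rule sum.reindex_bij_betw[OF bij, symmetric])
  also have "\<dots> = (\<Sum>u\<in>pverts G. ?f (degree G u))"
    by (rule sum.cong) (simp_all add: degree_\<tau>)
  finally have "(\<Sum>u\<in>nbhd G x. ?f (degree G u) - ?f (degree G u - 1)) =
      (\<Sum>u\<in>nbhd H (\<tau> x). ?f (degree H u) - ?f (degree H u - 1))"
    using G.sum_card_degree[OF x, of ?f] H.sum_card_degree[OF \<tau>_in_verts[OF x], of ?f]
      sum_card_degree_eq[OF x, of ?f] degree_\<tau>[OF x] by simp
  moreover have "(\<Sum>u\<in>nbhd G x. ?f (degree G u) - ?f (degree G u - 1)) =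
      (\<Sum>u\<in>nbhd G x. 2 * int (degree G u) - 1)"
    by (rule sum.cong) (auto simp only: sq G.degree_pos)
  moreover have "(\<Sum>u\<in>nbhd H (\<tau> x). ?f (degree H u) - ?f (degree H u - 1)) =
      (\<Sum>u\<in>nbhd H (\<tau> x). 2 * int (degree H u) - 1)"
    by (rule sum.cong) (auto simp only: sq H.degree_pos)
  ultimately show ?thesis
    using card_nbhd_\<tau>[OF x] by (simp add: sum_subtractf sum_distrib_left[symmetric])
qed

section \<open>Recovering the neighbourhood of the distinguished vertex\<close>

lemma nbhd_\<tau>_disjoint:
  assumes a: "a \<in> pverts G" and s: "s \<in> pverts G"
    and disj: "closed_nbhd G a \<inter> closed_nbhd G s = {}"
    and uniq: "\<And>u. u \<in> pverts G \<Longrightarrow> degree G u = degree G a \<Longrightarrow> u = a"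
    and gap: "\<And>u. u \<in> pverts G \<Longrightarrow> degree G u \<noteq> Suc (degree G a)"
  shows "\<tau> s \<notin> nbhd H (\<tau> a)" and "nbhd H (\<tau> a) \<inter> nbhd H (\<tau> s) = {}"
proof -
  have as: "a \<noteq> s" "s \<notin> nbhd G a" "a \<notin> nbhd G s" "nbhd G a \<inter> nbhd G s = {}"
    using disj by (auto simp: closed_nbhd_def)
  obtain \<psi> where \<psi>: "card_iso G s H (\<tau> s) \<psi>" using cards s by blast
  have a': "a \<in> pverts G - {s}" using a as by simp
  have deg: "card_degree H (\<tau> s) (\<psi> a) = degree G a"
    using card_iso_card_degree[OF \<psi> a'] G.degree_eq_card_degree[of a s] as by simp
  have "\<psi> a \<in> pverts H - {\<tau> s}" using \<psi> a' bij_betwE unfolding card_iso_def by blast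
  \<comment> \<open>Writing the image of \<open>a\<close> as \<open>\<tau> b\<close> makes its
    degree in \<open>H\<close> known, namely that of \<open>b\<close>. It is the degree of
    \<open>a\<close>, or one more if \<open>\<tau> b\<close> is adjacent to \<open>\<tau> s\<close>;
    \<open>gap\<close> excludes the latter, and then \<open>uniq\<close> yields
    \<open>b = a\<close>.\<close>
  then obtain b where b: "b \<in> pverts G" "\<psi> a = \<tau> b"
    using bij unfolding bij_betw_def by blast
  have deg_b: "degree G b = degree G a + of_bool (\<tau> b \<in> nbhd H (\<tau> s))"
    using H.degree_eq_card_degree[of "\<tau> b" "\<tau> s"] deg b degree_\<tau> by simp
  have b_nadj: "\<tau> b \<notin> nbhd H (\<tau> s)"
  proof
    assume "\<tau> b \<in> nbhd H (\<tau> s)"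
    then show False using deg_b gap[OF b(1)] by simp
  qed
  then have "b = a" using deg_b by (intro uniq b(1)) simp
  with b_nadj have \<psi>a: "\<psi> a = \<tau> a" and nadj: "\<tau> a \<notin> nbhd H (\<tau> s)" using b by simp_all
  then show ns: "\<tau> s \<notin> nbhd H (\<tau> a)" using H.nbhd_sym by blast
  \<comment> \<open>Neither neighbourhood contains the deleted vertex, so nothing is lost in passing
    to the cards.\<close>
  have im: "\<psi> ` nbhd G a = nbhd H (\<tau> a)"
    using card_iso_nbhd[OF \<psi> a'] \<psi>a as(2) ns by simp
  have inj: "inj_on \<psi> (nbhd G a)" using card_iso_inj_on_nbhd[OF \<psi>, of a] as(2) by simp
  have "(\<Sum>u\<in>nbhd H (\<tau> a). int (card_degree H (\<tau> s) u)) =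
      (\<Sum>u\<in>nbhd G a. int (card_degree H (\<tau> s) (\<psi> u)))"
    unfolding im[symmetric] using inj by (simp add: sum.reindex)
  also have "\<dots> = (\<Sum>u\<in>nbhd G a. int (degree G u))"
  proof (rule sum.cong)
    fix u assume u: "u \<in> nbhd G a"
    then have "u \<in> pverts G - {s}" using as(2) G.nbhd_subset by blast
    moreover have "u \<notin> nbhd G s" using u as(4) by blast
    ultimately show "int (card_degree H (\<tau> s) (\<psi> u)) = int (degree G u)"
      using card_iso_card_degree[OF \<psi>] G.degree_eq_card_degree[of u s] by simp
  qed simp
  also have "\<dots> = (\<Sum>u\<in>nbhd H (\<tau> a). int (degree H u))"
    using sum_nbhd_degree_\<tau>[OF a] by simp
  \<comment> \<open>The first summand is the sum at which the chain began. It cancels, and the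
    number of common neighbours of \<open>\<tau> a\<close> and \<open>\<tau> s\<close> must be
    0.\<close>
  also have "\<dots> = (\<Sum>u\<in>nbhd H (\<tau> a). int (card_degree H (\<tau> s) u))
      + (\<Sum>u\<in>nbhd H (\<tau> a). of_bool (u \<in> nbhd H (\<tau> s)))"
    by (simp add: H.degree_eq_card_degree[of _ "\<tau> s"] sum.distrib)
  finally have "(\<Sum>u\<in>nbhd H (\<tau> a). of_bool (u \<in> nbhd H (\<tau> s)) :: int) = 0" by simp
  then have "\<forall>u\<in>nbhd H (\<tau> a). (of_bool (u \<in> nbhd H (\<tau> s)) :: int) = 0"
    using H.finite_nbhd by (subst (asm) sum_nonneg_eq_0_iff) auto
  then show "nbhd H (\<tau> a) \<inter> nbhd H (\<tau> s) = {}" by auto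
qed

lemma isomorphic_of_dominating_set:
  assumes a: "a \<in> pverts G" and S: "S \<subseteq> pverts G"
    and cover: "closed_nbhd G a \<union> (\<Union>s\<in>S. closed_nbhd G s) = pverts G"
    and disj: "closed_nbhd G a \<inter> (\<Union>s\<in>S. closed_nbhd G s) = {}"
    and uniq: "\<And>u. u \<in> pverts G \<Longrightarrow> degree G u = degree G a \<Longrightarrow> u = a"
    and gap_a: "\<And>u. u \<in> pverts G \<Longrightarrow> degree G u \<noteq> Suc (degree G a)"
    and S_closed: "\<And>s u. s \<in> S \<Longrightarrow> u \<in> pverts G \<Longrightarrow> degree G u = degree G s \<Longrightarrow> u \<in> S"
    and gap_S: "\<And>s u. s \<in> S \<Longrightarrow> u \<in> pverts G \<Longrightarrow> degree G u \<noteq> Suc (degree G s)"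
  shows "digraph_iso (with_proj G) (with_proj H)"
proof -
  have nS: "s \<notin> nbhd G a" if "s \<in> S" for s
    using disj that by (auto simp: closed_nbhd_def)
  have disj_s: "closed_nbhd G a \<inter> closed_nbhd G s = {}" if "s \<in> S" for s
    using disj that by blast
  have nS': "\<tau> s \<notin> nbhd H (\<tau> a)" and disj': "nbhd H (\<tau> a) \<inter> nbhd H (\<tau> s) = {}"
    if "s \<in> S" for s
    using nbhd_\<tau>_disjoint[OF a _ disj_s[OF that] uniq gap_a] that S by blast+
  have inj: "inj_on \<tau> (pverts G)" and im: "\<tau> ` pverts G = pverts H"
    using bij by (auto simp: bij_betw_def)
  have a_notin: "a \<notin> S" using disj by (auto simp: closed_nbhd_def)
  obtain \<phi> where \<phi>: "card_iso G a H (\<tau> a) \<phi>" using cards a by blast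
  have \<phi>_inj: "inj_on \<phi> (pverts G - {a})" and \<phi>_im: "\<phi> ` (pverts G - {a}) = pverts H - {\<tau> a}"
    and \<phi>_adj: "\<And>u w. u \<in> pverts G - {a} \<Longrightarrow> w \<in> pverts G - {a} \<Longrightarrow>
      (u, w) \<in> parcs G \<longleftrightarrow> (\<phi> u, \<phi> w) \<in> parcs H"
    using \<phi> unfolding card_iso_def bij_betw_def by blast+
  let ?D = "degree G ` S"
  \<comment> \<open>Members of \<open>S\<close> are not adjacent to \<open>a\<close> and keep their
    degrees. Conversely, a card degree equal to that of some \<open>s\<close> in \<open>S\<close>
    comes from the same degree in \<open>G\<close>, since \<open>gap_S\<close> rules out one more,
    and \<open>S_closed\<close> applies.\<close>
  have mem_S: "u \<in> S \<longleftrightarrow> card_degree G a u \<in> ?D" if u: "u \<in> pverts G" for u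
  proof
    assume "u \<in> S"
    then show "card_degree G a u \<in> ?D"
      using nS G.degree_eq_card_degree[of u a] by (intro image_eqI[of _ _ u]) simp_all
  next
    assume "card_degree G a u \<in> ?D"
    then obtain s where s: "s \<in> S" "card_degree G a u = degree G s" by blast
    then show "u \<in> S"
      using G.degree_eq_card_degree[of u a] gap_S[OF s(1) u] S_closed[OF s(1) u]
      by (cases "u \<in> nbhd G a") simp_all
  qed
  have mem_S': "u \<in> S \<longleftrightarrow> card_degree H (\<tau> a) (\<tau> u) \<in> ?D" if u: "u \<in> pverts G" for u
  proof
    assume "u \<in> S"
    then show "card_degree H (\<tau> a) (\<tau> u) \<in> ?D"
      using nS' H.degree_eq_card_degree[of "\<tau> u" "\<tau> a"] degree_\<tau>[OF u]
      by (intro image_eqI[of _ _ u]) simp_all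
  next
    assume "card_degree H (\<tau> a) (\<tau> u) \<in> ?D"
    then obtain s where s: "s \<in> S" "card_degree H (\<tau> a) (\<tau> u) = degree G s" by blast
    then show "u \<in> S"
      using H.degree_eq_card_degree[of "\<tau> u" "\<tau> a"] degree_\<tau>[OF u]
        gap_S[OF s(1) u] S_closed[OF s(1) u]
      by (cases "\<tau> u \<in> nbhd H (\<tau> a)") simp_all
  qed
  \<comment> \<open>\<open>\<phi>\<close> and \<open>\<tau>\<close> may differ on single members of
    \<open>S\<close>, but membership depends only on the card degree, which \<open>\<phi>\<close>
    preserves.\<close>
  have \<phi>_S: "\<phi> u \<in> \<tau> ` S \<longleftrightarrow> u \<in> S" if u: "u \<in> pverts G - {a}" for u
  proof -
    have "\<phi> u \<in> pverts H" using \<phi>_im u by blast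
    then obtain w where w: "w \<in> pverts G" "\<phi> u = \<tau> w" using im by blast
    have "\<phi> u \<in> \<tau> ` S \<longleftrightarrow> w \<in> S" using w inj S by (simp add: inj_on_image_mem_iff)
    also have "\<dots> \<longleftrightarrow> u \<in> S"
      using mem_S'[OF w(1)] mem_S[of u] card_iso_card_degree[OF \<phi> u] u w by simp
    finally show ?thesis .
  qed
  have sub: "nbhd H (\<tau> a) \<subseteq> \<phi> ` nbhd G a"
  proof
    fix z assume z: "z \<in> nbhd H (\<tau> a)"
    then have "z \<in> pverts H - {\<tau> a}" using H.nbhd_subset H.nbhd_irrefl by blast
    then obtain u where u: "u \<in> pverts G - {a}" "z = \<phi> u" using \<phi>_im by blast
    have "u \<notin> closed_nbhd G s" if s: "s \<in> S" for s
    proof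
      assume "u \<in> closed_nbhd G s"
      then consider "u = s" | "u \<in> nbhd G s" by (auto simp: closed_nbhd_def)
      then show False
      proof cases
        case 1
        then have "z \<in> \<tau> ` S" using \<phi>_S[OF u(1)] u(2) s by simp
        then show False using nS' z by blast
      next
        case 2
        have s': "s \<in> pverts G - {a}" using s S a_notin by blast
        \<comment> \<open>The image of \<open>s\<close> is \<open>\<tau> t\<close> with
          \<open>t\<close> possibly different from \<open>s\<close>, so disjointness is invoked at
          \<open>t\<close>.\<close>
        then obtain t where t: "t \<in> S" "\<phi> s = \<tau> t" using \<phi>_S s by blast
        have "z \<in> nbhd H (\<phi> s)" using card_iso_nbhd[OF \<phi> s'] 2 u by blast
        then show False using disj'[OF t(1)] t(2) z by auto
      qed
    qed
    then have "u \<in> nbhd G a" using cover u(1) by (auto simp: closed_nbhd_def)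
    then show "z \<in> \<phi> ` nbhd G a" using u(2) by blast
  qed
  have inj_a: "inj_on \<phi> (nbhd G a)"
    using card_iso_inj_on_nbhd[OF \<phi>, of a] G.nbhd_irrefl[of a] by simp
  \<comment> \<open>The inclusion becomes an equality because \<open>a\<close> and
    \<open>\<tau> a\<close> have equal finite degrees.\<close>
  have nbhd_a: "nbhd H (\<tau> a) = \<phi> ` nbhd G a"
    using sub card_nbhd_\<tau>[OF a] card_image[OF inj_a]
    by (intro card_subset_eq finite_imageI G.finite_nbhd) simp_all
  \<comment> \<open>The extension of the card isomorphism by the deleted vertices;
    \<open>nbhd_a\<close> is what makes it respect the arcs at \<open>a\<close>.\<close>
  define \<theta> where "\<theta> = \<phi>(a := \<tau> a)"
  have "bij_betw \<theta> (pverts G) (pverts H)"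
  proof -
    have "bij_betw \<theta> (pverts G - {a}) (pverts H - {\<tau> a})"
      using \<phi> bij_betw_cong[of "pverts G - {a}" \<theta> \<phi>] by (simp add: card_iso_def \<theta>_def)
    then have "bij_betw \<theta> (insert a (pverts G - {a})) (insert (\<tau> a) (pverts H - {\<tau> a}))"
      using notIn_Un_bij_betw[of a "pverts G - {a}" \<theta> "pverts H - {\<tau> a}"]
      by (simp add: \<theta>_def)
    then show ?thesis using a \<tau>_in_verts[OF a] by (simp add: insert_absorb)
  qed
  moreover have "(u, w) \<in> parcs G \<longleftrightarrow> (\<theta> u, \<theta> w) \<in> parcs H"
    if u: "u \<in> pverts G" and w: "w \<in> pverts G" for u w
  proof -
    have adj_a: "(u, a) \<in> parcs G \<longleftrightarrow> (\<phi> u, \<tau> a) \<in> parcs H" if u: "u \<in> pverts G - {a}" for u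
    proof -
      have "(u, a) \<in> parcs G \<longleftrightarrow> u \<in> nbhd G a" using u by (simp add: nbhd_def)
      also have "\<dots> \<longleftrightarrow> \<phi> u \<in> \<phi> ` nbhd G a"
        using u G.nbhd_subset[of a] G.nbhd_irrefl[of a]
        by (intro inj_on_image_mem_iff[symmetric, OF \<phi>_inj]) blast+
      also have "\<dots> \<longleftrightarrow> (\<phi> u, \<tau> a) \<in> parcs H"
        unfolding nbhd_a[symmetric] using u \<phi>_im by (auto simp: nbhd_def)
      finally show ?thesis .
    qed
    have symG: "(p, q) \<in> parcs G \<longleftrightarrow> (q, p) \<in> parcs G" for p q using G.arcs_symmetric by blast
    have symH: "(p, q) \<in> parcs H \<longleftrightarrow> (q, p) \<in> parcs H" for p q using H.arcs_symmetric by blast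
    show ?thesis
    proof (cases "u = a"; cases "w = a")
      assume "u = a" "w = a"
      then show ?thesis using G.no_loops' H.no_loops' by blast
    next
      assume "u = a" "w \<noteq> a"
      then show ?thesis using adj_a[of w] w symG[of a w] symH[of "\<tau> a" "\<phi> w"] by (simp add: \<theta>_def)
    next
      assume "u \<noteq> a" "w = a"
      then show ?thesis using adj_a[of u] u by (simp add: \<theta>_def)
    next
      assume "u \<noteq> a" "w \<noteq> a"
      then show ?thesis using \<phi>_adj[of u w] u w by (simp add: \<theta>_def)
    qed
  qed
  ultimately show ?thesis
    by (intro G.digraph_isoI_with_proj H.pair_graph_axioms)
qed

end

section \<open>Reconstructibility from the enumerated conditions\<close>

theorem mainTheorem1:
  fixes G :: "'a pair_pre_digraph" and v :: "nat \<Rightarrow> 'a" and k n :: nat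
  assumes "pair_graph G"
    and "bij_betw v {1..n} (pverts G)"
    and "1 < k" and "k < n"
    and "(\<Union>i\<in>{1..k}. closed_nbhd G (v i)) = pverts G"
    and "closed_nbhd G (v 1) \<inter> (\<Union>i\<in>{2..k}. closed_nbhd G (v i)) = {}"
    and "\<forall>i\<in>{1..k}. \<forall>j\<in>{1..n} - {i}.
           \<bar>int (degree G (v i)) - int (degree G (v j))\<bar> \<noteq> 1"
    and "{u \<in> pverts G. degree G u = degree G (v 1)} = {v 1}"
    and "\<forall>i\<in>{2..k}. {u \<in> pverts G. degree G u = degree G (v i)} \<subseteq> v ` {2..k}"
  shows "reconstructible TYPE('b) G"
  unfolding reconstructible_def
proof (intro allI impI)
  fix G' :: "'b pair_pre_digraph" and m :: nat and w :: "nat \<Rightarrow> 'a" and w' :: "nat \<Rightarrow> 'b"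
  assume G': "pair_graph G'" and w: "bij_betw w {1..m} (pverts G)"
    and w': "bij_betw w' {1..m} (pverts G')"
    and iso: "\<forall>j\<in>{1..m}. digraph_iso (pre_digraph.del_vert (with_proj G) (w j))
                                 (pre_digraph.del_vert (with_proj G') (w' j))"
  \<comment> \<open>The enumeration \<open>w\<close> comes from the definition of
    \<open>reconstructible\<close> and is unrelated to \<open>v\<close>. Two vertices correspond
    when \<open>w\<close> and \<open>w'\<close> give them the same index.\<close>
  define \<tau> where "\<tau> = w' \<circ> inv_into {1..m} w"
  interpret hypomorphism G G' \<tau>
  proof (intro hypomorphism.intro hypomorphism_axioms.intro assms(1) G')
    show "bij_betw \<tau> (pverts G) (pverts G')"
      unfolding \<tau>_def using bij_betw_inv_into[OF w] w' by (rule bij_betw_trans)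
    show "\<exists>f. card_iso G x G' (\<tau> x) f" if "x \<in> pverts G" for x
    proof -
      obtain j where j: "j \<in> {1..m}" "x = w j" using w \<open>x \<in> pverts G\<close> unfolding bij_betw_def by blast
      then have "\<tau> x = w' j" using w by (simp add: \<tau>_def bij_betw_def)
      then show ?thesis using iso j by (intro digraph_iso_del_vert_imp_card_iso) simp
    qed
    show "3 \<le> card (pverts G)" using bij_betw_same_card[OF assms(2)] assms(3,4) by simp
  qed
  have v_im: "v ` {1..n} = pverts G" using assms(2) by (simp add: bij_betw_def)
  \<comment> \<open>The upward half of condition (3), freed from indices; for \<open>u = v i\<close>
    itself the claim is trivial.\<close>
  have gap: "degree G u \<noteq> Suc (degree G (v i))" if i: "i \<in> {1..k}" and u: "u \<in> pverts G" for i u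
  proof -
    obtain j where j: "j \<in> {1..n}" "u = v j" using v_im u by blast
    show ?thesis
    proof (cases "j = i")
      case False
      then have "\<bar>int (degree G (v i)) - int (degree G (v j))\<bar> \<noteq> 1"
        using assms(7) i j(1) by blast
      then show ?thesis using j(2) by auto
    qed (simp add: j(2))
  qed
  have "{1..k} = insert 1 {2..k}" using assms(3) by auto
  then have cover: "closed_nbhd G (v 1) \<union> (\<Union>s\<in>v ` {2..k}. closed_nbhd G s) = pverts G"
    using assms(5) by simp
  show "digraph_iso (with_proj G) (with_proj G')"
  proof (rule isomorphic_of_dominating_set[OF _ _ cover])
    show "v 1 \<in> pverts G" "v ` {2..k} \<subseteq> pverts G" using v_im assms(3,4) by auto
    show "closed_nbhd G (v 1) \<inter> (\<Union>s\<in>v ` {2..k}. closed_nbhd G s) = {}"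
      using assms(6) by simp
    show "u = v 1" if "u \<in> pverts G" "degree G u = degree G (v 1)" for u
      using assms(8) that by blast
    show "degree G u \<noteq> Suc (degree G (v 1))" if "u \<in> pverts G" for u
      using gap[OF _ that, of 1] assms(3) by simp
    show "u \<in> v ` {2..k}" if "s \<in> v ` {2..k}" "u \<in> pverts G" "degree G u = degree G s" for s u
      using assms(9) that by blast
    show "degree G u \<noteq> Suc (degree G s)" if "s \<in> v ` {2..k}" "u \<in> pverts G" for s u
      using gap that by auto
  qed
qed

end
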